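(* For every integer $k \ge 1$, $\tau(8^k) \le 6^k$.
   Context: All graphs are simple, undirected and finite. A graph is word-representable if there is a word $w$ over its vertex set such that two distinct vertices are adjacent iff their occurrences alternate in $w$. For a graph $G$, $\eta(G)$ is the maximum cardinality of a set $S \subseteq V(G)$ such that the induced subgraph $G[S]$ is word-representable. For a positive integer $n$, $\tau(n) = \min\{\eta(G) : G \text{ is a graph on } n \text{ vertices}\}$. *)

theory Defs
  imports "Graph_Theory.Digraph_Component"
begin

text \<open>
  Simple undirected finite graphs are the loop-free symmetric finite digraphs of
  the locales \<^locale>\<open>graph\<close> and \<^locale>\<open>pair_graph\<close>.
\<close>

text \<open>
  For \<open>x \<noteq> y\<close>: deleting all other letters from \<open>w\<close> leaves a word of the form
  \<open>xyxy\<dots>\<close> or \<open>yxyx\<dots>\<close> (of even or odd length).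
\<close>

definition alternate :: "'a \<Rightarrow> 'a \<Rightarrow> 'a list \<Rightarrow> bool" where
  "alternate x y w \<longleftrightarrow> distinct_adj (filter (\<lambda>z. z \<in> {x, y}) w)"

text \<open>As usual for word-representability, every vertex has to occur in the word.\<close>

definition word_representable :: "('a, 'b) pre_digraph \<Rightarrow> bool" where
  "word_representable G \<longleftrightarrow>
     (\<exists>w. set w = verts G \<and>
        (\<forall>x\<in>verts G. \<forall>y\<in>verts G. x \<noteq> y \<longrightarrow> (x \<rightarrow>\<^bsub>G\<^esub> y \<longleftrightarrow> alternate x y w)))"

definition eta :: "('a, 'b) pre_digraph \<Rightarrow> nat" where
  "eta G = Max {card S | S. S \<subseteq> verts G \<and> word_representable (G \<restriction> S)}"

text \<open>
  Every finite graph is isomorphic to one with vertices in \<^typ>\<open>nat\<close>, so the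
  minimum is taken over such graphs.
\<close>

definition tau :: "nat \<Rightarrow> nat" where
  "tau n = Min {eta (with_proj G) | G :: nat pair_pre_digraph.
                  pair_graph G \<and> card (pverts G) = n}"

text \<open>The maximum and the minimum above range over finite nonempty sets.\<close>

lemma eta_set_finite:
  assumes "finite (verts G)"
  shows "finite {card S | S. S \<subseteq> verts G \<and> word_representable (G \<restriction> S)}"
  using assms by simp

lemma eta_set_nonempty: "{card S | S. S \<subseteq> verts G \<and> word_representable (G \<restriction> S)} \<noteq> {}"
proof -
  have "word_representable (G \<restriction> {})"
    by (simp add: word_representable_def)
  then show ?thesis by blast
qed

lemma eta_le_card:
  assumes "finite (verts G)"
  shows "eta G \<le> card (verts G)"
  unfolding eta_def
  using eta_set_finite[OF assms] eta_set_nonempty[of G] assms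
  by (subst Max_le_iff) (auto intro: card_mono)

lemma tau_set_finite:
  "finite {eta (with_proj G) | G :: nat pair_pre_digraph. pair_graph G \<and> card (pverts G) = n}"
proof (rule finite_subset)
  show "{eta (with_proj G) | G :: nat pair_pre_digraph. pair_graph G \<and> card (pverts G) = n} \<subseteq> {..n}"
  proof clarsimp
    fix G :: "nat pair_pre_digraph"
    assume "pair_graph G"
    then have "finite (pverts G)"
      by (simp add: pair_graph_def pair_digraph_def pair_fin_digraph_def pair_fin_digraph_axioms_def)
    then show "eta (with_proj G) \<le> card (pverts G)"
      using eta_le_card[of "with_proj G"] by simp
  qed
qed simp

lemma tau_set_nonempty:
  "{eta (with_proj G) | G :: nat pair_pre_digraph. pair_graph G \<and> card (pverts G) = n} \<noteq> {}"
proof -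
  have "pair_graph \<lparr>pverts = {..<n}, parcs = {}\<rparr>"
    by unfold_locales (auto simp: symmetric_def sym_def)
  then show ?thesis by fastforce
qed

end

theory Submission
  imports Defs
begin

text \<open>
  The function \<open>\<tau>\<close> is submultiplicative: in a lexicographic product \<open>G[H]\<close>, choosing one
  vertex per nonempty fibre shows that a word-representable vertex set meets at most \<open>\<eta>(G)\<close>
  fibres, and it meets each of them in at most \<open>\<eta>(H)\<close> vertices.

  It remains to see \<open>\<tau>(8) \<le> 6\<close>. In a word-representable graph the neighbourhood of a vertex
  induces a comparability graph, so the wheel with five spokes is not word-representable.
  There is a graph on 8 vertices with four induced wheels whose complements partition the
  vertex set into pairs; a set of at least 7 vertices contains one of these wheels.
\<close>

section \<open>Representability of vertex sets\<close>

text \<open>A bare relation replaces the digraph record, so that vertex sets can be shrunk and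
  mapped without rebuilding a graph.\<close>

definition representable_on :: "('a \<times> 'a) set \<Rightarrow> 'a set \<Rightarrow> bool" where
  "representable_on R S \<longleftrightarrow>
     (\<exists>w. set w = S \<and> (\<forall>x\<in>S. \<forall>y\<in>S. x \<noteq> y \<longrightarrow> ((x, y) \<in> R \<longleftrightarrow> alternate x y w)))"

lemma alternate_commute: "alternate x y w \<longleftrightarrow> alternate y x w"
  by (simp add: alternate_def insert_commute)

lemma alternate_filter:
  assumes "x \<in> T" "y \<in> T"
  shows "alternate x y (filter (\<lambda>z. z \<in> T) w) \<longleftrightarrow> alternate x y w"
proof -
  have "filter (\<lambda>z. z \<in> {x, y}) (filter (\<lambda>z. z \<in> T) w) = filter (\<lambda>z. z \<in> {x, y}) w"
    using assms by (auto simp: filter_filter intro: filter_cong)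
  then show ?thesis by (simp add: alternate_def)
qed

lemma alternate_map:
  assumes "inj_on f (set w)" "x \<in> set w" "y \<in> set w"
  shows "alternate (f x) (f y) (map f w) \<longleftrightarrow> alternate x y w"
proof -
  have "filter (\<lambda>z. z \<in> {f x, f y}) (map f w) = map f (filter (\<lambda>z. z \<in> {x, y}) w)"
    using assms
    by (auto simp: filter_map o_def inj_on_eq_iff intro!: arg_cong[of _ _ "map f"] filter_cong)
  moreover have "inj_on f (set (filter (\<lambda>z. z \<in> {x, y}) w))"
    using assms(1) by (rule inj_on_subset) auto
  ultimately show ?thesis by (simp add: alternate_def distinct_adj_map_iff)
qed

lemma representable_on_subset:
  assumes "representable_on R S" "T \<subseteq> S"
  shows "representable_on R T"
proof -
  obtain w where w: "set w = S"
      "\<forall>x\<in>S. \<forall>y\<in>S. x \<noteq> y \<longrightarrow> ((x, y) \<in> R \<longleftrightarrow> alternate x y w)"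
    using assms(1) by (auto simp: representable_on_def)
  have "set (filter (\<lambda>z. z \<in> T) w) = T" using w(1) assms(2) by auto
  moreover have "(x, y) \<in> R \<longleftrightarrow> alternate x y (filter (\<lambda>z. z \<in> T) w)"
    if "x \<in> T" "y \<in> T" "x \<noteq> y" for x y
    using that w(2) assms(2) by (auto simp: alternate_filter subset_iff)
  ultimately show ?thesis unfolding representable_on_def by blast
qed

text \<open>Serves three transfers: between a graph and its copy over \<open>nat\<close>, from a
  fibre of a product to the second factor, and from a transversal of the fibres to the
  first.\<close>

lemma representable_on_image:
  assumes "representable_on R S" and inj: "inj_on f S"
    and R': "\<And>x y. x \<in> S \<Longrightarrow> y \<in> S \<Longrightarrow> x \<noteq> y \<Longrightarrow> (f x, f y) \<in> R' \<longleftrightarrow> (x, y) \<in> R"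
  shows "representable_on R' (f ` S)"
proof -
  obtain w where w: "set w = S"
      "\<forall>x\<in>S. \<forall>y\<in>S. x \<noteq> y \<longrightarrow> ((x, y) \<in> R \<longleftrightarrow> alternate x y w)"
    using assms(1) by (auto simp: representable_on_def)
  have "(u, v) \<in> R' \<longleftrightarrow> alternate u v (map f w)"
    if uv: "u \<in> f ` S" "v \<in> f ` S" "u \<noteq> v" for u v
  proof -
    obtain x y where xy: "x \<in> S" "y \<in> S" "u = f x" "v = f y" using uv by blast
    then have "x \<noteq> y" using uv by blast
    with xy R' w inj show ?thesis by (simp add: alternate_map)
  qed
  moreover have "set (map f w) = f ` S" using w by simp
  ultimately show ?thesis unfolding representable_on_def by blast
qed

lemma word_representable_induce_subgraph:
  "word_representable (with_proj G \<restriction> S) \<longleftrightarrow> representable_on (parcs G) S"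
proof -
  have "x \<rightarrow>\<^bsub>with_proj G \<restriction> S\<^esub> y \<longleftrightarrow> (x, y) \<in> parcs G" if "x \<in> S" "y \<in> S" for x y
    using that by (auto simp: arcs_ends_def arc_to_ends_def image_iff)
  then show ?thesis
    by (simp add: word_representable_def representable_on_def)
qed

section \<open>The neighbourhood of a vertex\<close>

text \<open>Alternation with \<open>x\<close> first, or with neither letter present. The form with
  prefix counts lets two letters be compared through a third one.\<close>

definition leads :: "'a list \<Rightarrow> 'a \<Rightarrow> 'a \<Rightarrow> bool" where
  "leads w x y \<longleftrightarrow> (\<forall>n. count_list (take n w) y \<le> count_list (take n w) x \<and>
                        count_list (take n w) x \<le> Suc (count_list (take n w) y))"

lemma all_nat_Suc: "(\<forall>n. P n) \<longleftrightarrow> P 0 \<and> (\<forall>n. P (Suc n))"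
  by (metis not0_implies_Suc)

text \<open>Reading \<open>x\<close> uses up its lead, so the roles are exchanged for the rest;
  reading \<open>y\<close> first violates the inequalities at the prefix of length 1.\<close>

lemma leads_Cons:
  assumes "x \<noteq> y"
  shows "leads (z # w) x y \<longleftrightarrow> (if z = x then leads w y x else z \<noteq> y \<and> leads w x y)"
proof (cases "z = y")
  case True
  then have "\<not> leads (z # w) x y"
    using assms unfolding leads_def by (intro notI) (drule spec[of _ 1], simp)
  with True assms show ?thesis by simp
next
  case False
  with assms show ?thesis unfolding leads_def by (subst all_nat_Suc) auto
qed

lemma leads_iff:
  assumes "x \<noteq> y"
  shows "leads w x y \<longleftrightarrow> alternate x y w \<and>
           (filter (\<lambda>z. z \<in> {x, y}) w = [] \<or> hd (filter (\<lambda>z. z \<in> {x, y}) w) = x)"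
  using assms
proof (induction w arbitrary: x y)
  case Nil
  then show ?case by (simp add: leads_def alternate_def)
next
  case (Cons z w)
  have "filter (\<lambda>u. u \<in> {y, x}) w = filter (\<lambda>u. u \<in> {x, y}) w" by (simp add: insert_commute)
  moreover have "filter (\<lambda>u. u \<in> {x, y}) w = [] \<or> hd (filter (\<lambda>u. u \<in> {x, y}) w) \<in> {x, y}"
    by (metis (no_types, lifting) hd_in_set mem_Collect_eq set_filter)
  ultimately show ?case
    using Cons.prems Cons.IH[of x y] Cons.IH[of y x]
    by (auto simp: leads_Cons alternate_def distinct_adj_Cons)
qed

lemma alternate_iff_leads:
  assumes "x \<noteq> y"
  shows "alternate x y w \<longleftrightarrow> leads w x y \<or> leads w y x"
proof -
  have "filter (\<lambda>u. u \<in> {y, x}) w = filter (\<lambda>u. u \<in> {x, y}) w" by (simp add: insert_commute)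
  moreover have "filter (\<lambda>u. u \<in> {x, y}) w = [] \<or> hd (filter (\<lambda>u. u \<in> {x, y}) w) \<in> {x, y}"
    by (metis (no_types, lifting) hd_in_set mem_Collect_eq set_filter)
  ultimately show ?thesis
    using assms alternate_commute[of x y w] by (auto simp: leads_iff)
qed

text \<open>
  Discounting an initial occurrence before the first \<open>h\<close>, the number of occurrences of any
  neighbour of \<open>h\<close> in a prefix is that of \<open>h\<close> or one less. Two neighbours therefore alternate
  iff these discounted counts are comparable pointwise.
\<close>

lemma neighbours_comparability:
  assumes nb: "\<And>x. x \<in> X \<Longrightarrow> x \<noteq> h \<and> alternate x h w"
  shows "\<exists>le. transp le \<and>
           (\<forall>x\<in>X. \<forall>y\<in>X. x \<noteq> y \<longrightarrow> (alternate x y w \<longleftrightarrow> le x y \<or> le y x))"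
proof -
  \<comment> \<open>Values are integers because \<open>M x 0\<close> is -1 when \<open>x\<close>
    leads \<open>h\<close>. At every \<open>n\<close>, for \<open>x\<close> in \<open>X\<close>,
    \<open>M x n\<close> is the count of \<open>h\<close> or one less.\<close>
  define M where "M = (\<lambda>x n. int (count_list (take n w) x) - (if leads w x h then 1 else 0))"
  define le where "le = (\<lambda>x y. \<forall>n. M x n \<le> M y n)"
  have h: "leads w x h \<or> leads w h x" if "x \<in> X" for x
    using nb[OF that] alternate_iff_leads by metis
  have mixed: "alternate x y w \<longleftrightarrow> le x y \<or> le y x"
    if "x \<noteq> y" "leads w x h" "\<not> leads w y h" "leads w h y" for x y
  proof -
    have hx: "count_list (take n w) h \<le> count_list (take n w) x"
      and hy: "count_list (take n w) y \<le> count_list (take n w) h" for n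
      using that(2,4) by (auto simp: leads_def)
    have yx: "count_list (take n w) y \<le> count_list (take n w) x" for n
      using hx[of n] hy[of n] by linarith
    have "int k - 1 \<le> int l \<longleftrightarrow> k \<le> Suc l" for k l by auto
    \<comment> \<open>Here the count of \<open>y\<close> never exceeds that of \<open>x\<close>, so
      \<open>leads w x y\<close> reduces to its second inequality, which is
      \<open>M x n \<le> M y n\<close>.\<close>
    then have "le x y \<longleftrightarrow> leads w x y"
      using that(2,3) yx by (simp add: le_def M_def leads_def[of w x y])
    \<comment> \<open>The empty prefix separates them: \<open>M x 0\<close> is -1 and
      \<open>M y 0\<close> is 0.\<close>
    moreover have "\<not> le y x"
      using that(2,3) by (auto simp: le_def M_def intro: exI[of _ 0])
    moreover have "leads w y x \<Longrightarrow> leads w x y"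
      using yx by (auto simp: leads_def intro: le_SucI)
    ultimately show ?thesis using that(1) by (auto simp: alternate_iff_leads)
  qed
  have "alternate x y w \<longleftrightarrow> le x y \<or> le y x" if xy: "x \<in> X" "y \<in> X" "x \<noteq> y" for x y
  proof (cases "leads w x h = leads w y h")
    case True
    \<comment> \<open>Both counts lie in the same window of two consecutive values, fixed by the
      count of \<open>h\<close>. Only the comparison without \<open>Suc\<close> remains in
      \<open>leads\<close>, and the smaller letter under \<open>le\<close> is the one that
      follows.\<close>
    have diff: "count_list (take n w) x \<le> Suc (count_list (take n w) y)"
        "count_list (take n w) y \<le> Suc (count_list (take n w) x)" for n
      using True h[OF xy(1)] h[OF xy(2)] unfolding leads_def by (meson le_trans Suc_le_mono)+
    have "le x y \<longleftrightarrow> leads w y x" "le y x \<longleftrightarrow> leads w x y"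
      using True diff by (auto simp: le_def M_def leads_def)
    with xy show ?thesis by (auto simp: alternate_iff_leads)
  next
    case False
    then show ?thesis
      using mixed[of x y] mixed[of y x] xy h alternate_commute[of x y w] by metis
  qed
  moreover have "transp le"
    by (auto simp: le_def transp_def intro: order_trans)
  ultimately show ?thesis by blast
qed

text \<open>Two consecutive edges oriented the same way would compose to a chord. Hence orientations
  alternate around the cycle, which is impossible for odd length. The ten instances of transitivity
  are the paths of length two in both directions.\<close>

lemma five_cycle_not_comparability:
  assumes "transp le"
    and "le a b \<or> le b a" "le b c \<or> le c b" "le c d \<or> le d c" "le d e \<or> le e d" "le e a \<or> le a e"
    and "\<not> (le a c \<or> le c a)" "\<not> (le b d \<or> le d b)" "\<not> (le c e \<or> le e c)"
      "\<not> (le d a \<or> le a d)" "\<not> (le e b \<or> le b e)"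
  shows False
proof -
  have "le x z" if "le x y" "le y z" for x y z using assms(1) that by (rule transpD)
  from this[of a b c] this[of b c d] this[of c d e] this[of d e a] this[of e a b]
    this[of c b a] this[of d c b] this[of e d c] this[of a e d] this[of b a e]
  show False using assms(2-) by argo
qed

text \<open>All rim vertices are neighbours of the hub \<open>h\<close>, so a representing word
  would make the rim, an induced 5-cycle, a comparability graph.\<close>

lemma wheel_not_representable:
  assumes rep: "representable_on R S"
    and sub: "{h, a, b, c, d, e} \<subseteq> S" and dist: "distinct [h, a, b, c, d, e]"
    and hub: "{(a, h), (b, h), (c, h), (d, h), (e, h)} \<subseteq> R"
    and rim: "{(a, b), (b, c), (c, d), (d, e), (e, a)} \<subseteq> R"
    and chords: "{(a, c), (b, d), (c, e), (d, a), (e, b)} \<inter> R = {}"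
  shows False
proof -
  obtain w where w: "\<And>x y. x \<in> S \<Longrightarrow> y \<in> S \<Longrightarrow> x \<noteq> y \<Longrightarrow> (x, y) \<in> R \<longleftrightarrow> alternate x y w"
    using rep by (auto simp: representable_on_def)
  have "x \<noteq> h \<and> alternate x h w" if "x \<in> {a, b, c, d, e}" for x
    using that w[of x h] sub dist hub by auto
  from neighbours_comparability[of "{a, b, c, d, e}", OF this] obtain le where "transp le"
    and le: "\<And>x y. x \<in> {a, b, c, d, e} \<Longrightarrow> y \<in> {a, b, c, d, e} \<Longrightarrow> x \<noteq> y \<Longrightarrow>
               alternate x y w \<longleftrightarrow> le x y \<or> le y x"
    by metis
  have "(x, y) \<in> R \<longleftrightarrow> le x y \<or> le y x"
    if "x \<in> {a, b, c, d, e}" "y \<in> {a, b, c, d, e}" "x \<noteq> y" for x y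
    using that w[of x y] le[of x y] sub by auto
  then show False
    using five_cycle_not_comparability[OF \<open>transp le\<close>, of a b c d e] dist rim chords by auto
qed

section \<open>Bounds on \<open>\<tau>\<close>\<close>

text \<open>Allows a witness graph over any type, such as pairs for products; an injection copies it
  to \<open>nat\<close>, and representable sets of the copy are pulled back.\<close>

lemma tau_card_le:
  fixes V :: "'a set" and R :: "('a \<times> 'a) set"
  assumes fin: "finite V" and RV: "R \<subseteq> V \<times> V" and "sym R" "irrefl R"
    and bound: "\<And>S. S \<subseteq> V \<Longrightarrow> representable_on R S \<Longrightarrow> card S \<le> b"
  shows "tau (card V) \<le> b"
proof -
  obtain f :: "'a \<Rightarrow> nat" where f: "inj_on f V"
    using finite_imp_inj_to_nat_seg[OF fin] by blast
  define G where "G = \<lparr>pverts = f ` V, parcs = map_prod f f ` R\<rparr>"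
  have arcs: "(f x, f y) \<in> parcs G \<longleftrightarrow> (x, y) \<in> R" if "x \<in> V" "y \<in> V" for x y
  proof
    assume "(f x, f y) \<in> parcs G"
    then obtain x' y' where "(x', y') \<in> R" "f x = f x'" "f y = f y'" by (auto simp: G_def)
    with that RV inj_onD[OF f, of x x'] inj_onD[OF f, of y y'] show "(x, y) \<in> R" by auto
  qed (auto simp: G_def)
  have "pair_graph G"
  proof unfold_locales
    show "finite (parcs G)"
      using finite_subset[OF RV] fin by (simp add: G_def)
    show "symmetric (with_proj G)"
      using \<open>sym R\<close> by (fastforce simp: symmetric_def sym_def G_def arcs_ends_def arc_to_ends_def)
    show "fst e \<noteq> snd e" if e: "e \<in> parcs G" for e
    proof -
      obtain x y where "(x, y) \<in> R" "e = (f x, f y)" using e by (auto simp: G_def)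
      with RV \<open>irrefl R\<close> inj_onD[OF f, of x y] show ?thesis by (auto simp: irrefl_def)
    qed
  qed (use RV fin in \<open>auto simp: G_def\<close>)
  moreover have "card (pverts G) = card V" by (simp add: G_def card_image f)
  ultimately have "tau (card V) \<le> eta (with_proj G)"
    unfolding tau_def by (intro Min_le tau_set_finite) blast
  also have "eta (with_proj G) \<le> b"
  proof -
    have "card T \<le> b" if T: "T \<subseteq> pverts G" "representable_on (parcs G) T" for T
    proof -
      obtain S where S: "S \<subseteq> V" "T = f ` S"
        using T(1) by (auto simp: G_def subset_image_iff)
      have inj: "inj_on f S" using f S(1) by (rule inj_on_subset)
      have inv: "inv_into S f ` T = S" "inj_on (inv_into S f) T"
        using S inj by (auto simp: image_inv_into_cancel inv_into_image_cancel intro: inj_on_inv_into)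
      have "(inv_into S f x, inv_into S f y) \<in> R \<longleftrightarrow> (x, y) \<in> parcs G"
        if "x \<in> T" "y \<in> T" for x y
        using that S inj arcs by (auto simp: inv_into_f_f subset_iff)
      then have "representable_on R S"
        using representable_on_image[OF T(2) inv(2)] inv(1) by metis
      then show ?thesis using bound S inj by (simp add: card_image)
    qed
    moreover have "finite (verts (with_proj G))" using fin by (simp add: G_def)
    ultimately show ?thesis
      unfolding eta_def using eta_set_nonempty[of "with_proj G"] eta_set_finite[of "with_proj G"]
      by (subst Max_le_iff) (auto simp: word_representable_induce_subgraph)
  qed
  finally show ?thesis .
qed

lemma tau_attained:
  obtains V :: "nat set" and R where "finite V" "card V = n" "R \<subseteq> V \<times> V" "sym R" "irrefl R"
    "\<And>S. S \<subseteq> V \<Longrightarrow> representable_on R S \<Longrightarrow> card S \<le> tau n"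
proof -
  obtain G :: "nat pair_pre_digraph" where G: "pair_graph G" "card (pverts G) = n"
      "tau n = eta (with_proj G)"
    using Min_in[OF tau_set_finite tau_set_nonempty, of n] unfolding tau_def by auto
  interpret pair_graph G by (rule G(1))
  have "card S \<le> tau n" if "S \<subseteq> pverts G" "representable_on (parcs G) S" for S
    unfolding G(3) eta_def using that eta_set_finite[of "with_proj G"]
    by (intro Max_ge) (auto simp: word_representable_induce_subgraph)
  moreover have "sym (parcs G)"
    using sym_arcs by (simp add: symmetric_def)
  moreover have "irrefl (parcs G)" using no_loops by (force simp: irrefl_def)
  moreover have "parcs G \<subseteq> pverts G \<times> pverts G" using in_arcsD1 in_arcsD2 by auto
  moreover have "finite (pverts G)" using finite_verts by simp
  ultimately show ?thesis using that[of "pverts G" "parcs G"] G(2) by blast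
qed

lemma tau_mult_le: "tau (m * n) \<le> tau m * tau n"
proof -
  obtain V :: "nat set" and R where V: "finite V" "card V = m" "R \<subseteq> V \<times> V" "sym R" "irrefl R"
    and boundV: "\<And>S. S \<subseteq> V \<Longrightarrow> representable_on R S \<Longrightarrow> card S \<le> tau m"
    by (rule tau_attained) blast
  obtain W :: "nat set" and Q where W: "finite W" "card W = n" "Q \<subseteq> W \<times> W" "sym Q" "irrefl Q"
    and boundW: "\<And>S. S \<subseteq> W \<Longrightarrow> representable_on Q S \<Longrightarrow> card S \<le> tau n"
    by (rule tau_attained) blast
  \<comment> \<open>The lexicographic product: \<open>R\<close> decides between different fibres,
    \<open>Q\<close> inside a fibre.\<close>
  define P where "P = {((a, c), (b, d)). c \<in> W \<and> d \<in> W \<and>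
                         ((a, b) \<in> R \<or> a \<in> V \<and> a = b \<and> (c, d) \<in> Q)}"
  have "card S \<le> tau m * tau n" if S: "S \<subseteq> V \<times> W" "representable_on P S" for S
  proof -
    have finS: "finite S" using S(1) V(1) W(1) finite_subset by blast
    have fibre: "card (S \<inter> {a} \<times> W) \<le> tau n" if "a \<in> V" for a
    proof -
      have inj: "inj_on snd (S \<inter> {a} \<times> W)" by (auto simp: inj_on_def)
      have "representable_on Q (snd ` (S \<inter> {a} \<times> W))"
        using that V(5) by (intro representable_on_image[OF representable_on_subset[OF S(2)] inj])
          (auto simp: P_def irrefl_def)
      then show ?thesis using boundW[of "snd ` (S \<inter> {a} \<times> W)"] card_image[OF inj]
        by fastforce
    qed
    \<comment> \<open>One representative per nonempty fibre. Distinct representatives differ in the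
      first coordinate, so \<open>P\<close> agrees with \<open>R\<close> on them.\<close>
    define r where "r = inv_into S fst"
    have r: "r a \<in> S" "fst (r a) = a" if "a \<in> fst ` S" for a
      using that by (simp_all add: r_def inv_into_into f_inv_into_f)
    have "representable_on R (fst ` r ` fst ` S)"
    proof (rule representable_on_image[OF representable_on_subset[OF S(2)]])
      show "r ` fst ` S \<subseteq> S" using r(1) by blast
      show "inj_on fst (r ` fst ` S)" using r(2) by (auto simp: inj_on_def)
      show "(fst x, fst y) \<in> R \<longleftrightarrow> (x, y) \<in> P"
        if "x \<in> r ` fst ` S" "y \<in> r ` fst ` S" "x \<noteq> y" for x y
      proof -
        have "fst x \<noteq> fst y" using that r(2) by (metis imageE)
        moreover have "snd x \<in> W" "snd y \<in> W" using that r(1) S(1) by fastforce+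
        ultimately show ?thesis by (auto simp: P_def split_beta)
      qed
    qed
    also have "fst ` r ` fst ` S = fst ` S" using r(2) by (force simp: image_image)
    finally have base: "card (fst ` S) \<le> tau m"
      using boundV[of "fst ` S"] S(1) by fastforce
    have "S = (\<Union>a\<in>fst ` S. S \<inter> {a} \<times> W)" using S(1) by force
    then have "card S \<le> (\<Sum>a\<in>fst ` S. card (S \<inter> {a} \<times> W))"
      using card_UN_le[of "fst ` S" "\<lambda>a. S \<inter> {a} \<times> W"] finS by simp
    also have "\<dots> \<le> (\<Sum>a\<in>fst ` S. tau n)"
      using S(1) by (intro sum_mono fibre) auto
    also have "\<dots> \<le> tau m * tau n" using base by simp
    finally show ?thesis .
  qed
  moreover have "P \<subseteq> (V \<times> W) \<times> (V \<times> W)" using V(3) by (auto simp: P_def)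
  moreover have "sym P" using V(4) W(4) by (auto simp: P_def sym_def)
  moreover have "irrefl P" using V(5) W(5) by (auto simp: P_def irrefl_def)
  ultimately have "tau (card (V \<times> W)) \<le> tau m * tau n"
    using V(1) W(1) by (intro tau_card_le[of _ P]) auto
  then show ?thesis using V(2) W(2) by (simp add: card_cartesian_product)
qed

lemma tau_8_le: "tau 8 \<le> 6"
proof -
  \<comment> \<open>Two paths 0-1-2-3 and 5-4-6-7, with every edge between them except those joining
    two inner vertices. Each path closes to an induced 5-cycle through an inner vertex of the other
    path, with the endpoint next to that vertex as a hub.\<close>
  define A :: "(nat \<times> nat) set" where
    "A = {(0,1), (0,4), (0,5), (0,6), (0,7), (1,2), (1,5), (1,7), (2,3), (2,5), (2,7),
          (3,4), (3,5), (3,6), (3,7), (4,5), (4,6), (6,7)}"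
  define R where "R = A \<union> A\<inverse>"
  \<comment> \<open>The order of the elements matters for unification: the hub comes first, then the
    rim in cyclic order. The omitted pairs are 6,7 and 4,5 and 2,3 and 0,1.\<close>
  have wheels: "\<not> {5, 0, 1, 2, 3, 4} \<subseteq> S" "\<not> {7, 0, 1, 2, 3, 6} \<subseteq> S"
      "\<not> {0, 1, 5, 4, 6, 7} \<subseteq> S" "\<not> {3, 2, 5, 4, 6, 7} \<subseteq> S"
    if rep: "representable_on R S" for S
    by (rule notI, erule wheel_not_representable[OF rep]; simp add: R_def A_def)+
  have "card S \<le> 6" if S: "S \<subseteq> {..<8}" "representable_on R S" for S
  proof (rule ccontr)
    assume "\<not> card S \<le> 6"
    then have "card ({..<8} - S) \<le> 1"
      using S(1) by (subst card_Diff_subset) (auto intro: finite_subset)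
    then have "x = y" if "x \<in> {..<8} - S" "y \<in> {..<8} - S" for x y
      using that by (simp add: card_le_Suc0_iff_eq)
    \<comment> \<open>\<open>v\<close> is the only vertex that \<open>S\<close> can miss, and is
      arbitrary if \<open>S\<close> is everything. It must lie in all four wheels, but every vertex
      is omitted by one of them.\<close>
    then obtain v where "{..<8} - {v} \<subseteq> S" by blast
    then have "v \<in> T" if "\<not> T \<subseteq> S" "T \<subseteq> {..<8}" for T using that by blast
    from this[OF wheels(1)] this[OF wheels(2)] this[OF wheels(3)] this[OF wheels(4)]
    have "v \<in> {5, 0, 1, 2, 3, 4} \<inter> {7, 0, 1, 2, 3, 6} \<inter> {0, 1, 5, 4, 6, 7} \<inter> {3, 2, 5, 4, 6, 7}"
      using S(2) by (intro IntI) simp_all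
    then show False by simp
  qed
  moreover have "R \<subseteq> {..<8} \<times> {..<8}" "irrefl R"
    by (auto simp: R_def A_def irrefl_def)
  moreover have "sym R" by (simp add: R_def sym_Un_converse)
  ultimately have "tau (card {..<8::nat}) \<le> 6" by (intro tau_card_le[of _ R]) auto
  then show ?thesis by simp
qed

theorem theorem13:
  fixes k :: nat
  assumes "k \<ge> 1"
  shows "tau (8 ^ k) \<le> 6 ^ k"
  using assms
proof (induction k rule: nat_induct_at_least)
  case base
  show ?case using tau_8_le by simp
next
  case (Suc k)
  have "tau (8 ^ Suc k) \<le> tau 8 * tau (8 ^ k)" by (simp add: tau_mult_le)
  also have "\<dots> \<le> 6 * 6 ^ k" using Suc tau_8_le by (intro mult_le_mono)
  finally show ?case by simp
qed

end
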